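(* Suppose that (KCI) holds. Then the mapping $\phi\colon U\to K$ defined for all $(a_i)_{i\in I}\in P^I$ by $\phi(a_i)_{i\in I}:=(a_i)_{i\in I}$ and $\phi((\eta a_i)_{i\in I})=(\eta a_{\lambda i})_{i\in I}$ is an isomorphism of the PEA $(U;+_U,0_U,1_U)$ onto the partial algebra $(K;+,0_K,1_K)$ such that the restriction of $\phi$ to $P^I$ is the identity mapping. Therefore, $(K;+,0_K,1_K)$ is a PEA, $K$ is a kite algebra, and $\phi\colon U\to K$ is a PEA-isomorphism. Furthermore, if $\psi\colon U\to K$ is any PEA-morphism such that the restriction of $\psi$ to $P^I$ is the identity mapping, then $\psi=\phi$.
   Context: $(P;\oplus,0)$ is a GPEA (partial operation $\oplus$, constant $0$, satisfying: associativity in the sense that $a\oplus b$ and $(a\oplus b)\oplus c$ exist iff $b\oplus c$ and $a\oplus(b\oplus c)$ exist and then they are equal; if $a\oplus b$ exists there are $c,d$ with $a\oplus b=c\oplus a=b\oplus d$; two-sided cancellation; $0$ is neutral; $a\oplus b=0$ implies $a=b=0$). Order: $a\le b$ iff $a\oplus c=b$ for some $c$; for $a\le b$, $a/b$ is the unique $c$ with $a\oplus c=b$ and $b\backslash a$ is the unique $d$ with $d\oplus a=b$. $I$ is a nonempty index set, $\lambda,\rho\colon I\to I$ are bijections, $P^I$ is a GPEA under coordinatewise $\oplus$ with zero $0^I$. $P^\eta$ is a set disjoint from $P$ with a bijection $\eta\colon P\to P^\eta$; $\eta$ also denotes the coordinatewise map $P^I\to(P^\eta)^I$. $K:=P^I\cup(P^\eta)^I$,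 $0_K:=0^I$, $1_K:=(\eta 0)_{i\in I}$, and $+$ on $K$ is: (K1) $(a_i)+(b_i):=(a_i\oplus b_i)$ iff $a_i\oplus b_i$ exists for all $i$; (K2) $(a_i)+(\eta b_i):=(\eta(b_i\backslash a_{\lambda i}))$ iff $a_{\lambda i}\le b_i$ for all $i$; (K3) $(\eta a_i)+(b_i):=(\eta(b_{\rho i}/a_i))$ iff $b_{\rho i}\le a_i$ for all $i$; (K4) $(\eta a_i)+(\eta b_i)$ undefined. If $K$ is a PEA, it is called the kite algebra. Condition (KCI): for all $(a_i),(b_i)\in P^I$ and all $i\in I$, $a_{\rho i}\oplus b_i$ exists iff $b_i\oplus a_{\lambda i}$ exists. Define $\gamma(a_i)_{i\in I}:=(a_{\rho\lambda^{-1}i})_{i\in I}$; (KCI) holds iff $\gamma$ is a unitizing GPEA-automorphism of $P^I$ (i.e. $\gamma x\oplus y$ defined iff $y\oplus x$ defined). Then $U$ is the $\gamma$-unitization of $P^I$, which as a set equals $K$, with $0_U=0_K$, $1_U=1_K$ and: (U1) $(a_i)+_U(b_i):=(a_i\oplus b_i)$ iff all $a_i\oplus b_i$ defined; (U2) $(a_i)+_U(\eta b_i):=(\eta(b_i\backslash a_i))$ iff $a_i\le b_i$ for all $i$; (U3) $(\eta a_i)+_U(b_i):=(\eta(b_{\rho\lambda^{-1}i}/a_i))$ iff $b_{\rho\lambda^{-1}i}\le a_i$ for all $i$; (U4) $(\eta a_i)+_U(\eta b_i)$ undefined. $U$ is a PEA (PEA = GPEA with a largest element). *)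

theory Defs
  imports Main "HOL-Library.FuncSet"
begin

text \<open>Partial algebras have an explicit carrier; \<open>padd A a b = None\<close> means that
  \<open>a \<oplus> b\<close> does not exist. Values of \<open>padd A\<close> outside the carrier are irrelevant.\<close>

record 'a partial_algebra =
  carrier :: "'a set"
  padd :: "'a \<Rightarrow> 'a \<Rightarrow> 'a option"
  pzero :: 'a

record 'a unital_partial_algebra = "'a partial_algebra" +
  pone :: 'a

text \<open>In the associativity axiom, the equation between the two \<open>Option.bind\<close> terms says that
  one side exists iff the other does, and that they are then equal.\<close>

definition gpea :: "('a, 'z) partial_algebra_scheme \<Rightarrow> bool" where
  "gpea A \<longleftrightarrow>
     pzero A \<in> carrier A \<and>
     (\<forall>a\<in>carrier A. \<forall>b\<in>carrier A. \<forall>c. padd A a b = Some c \<longrightarrow> c \<in> carrier A) \<and>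
     (\<forall>a\<in>carrier A. \<forall>b\<in>carrier A. \<forall>c\<in>carrier A.
        Option.bind (padd A a b) (\<lambda>s. padd A s c) = Option.bind (padd A b c) (\<lambda>s. padd A a s)) \<and>
     (\<forall>a\<in>carrier A. \<forall>b\<in>carrier A. padd A a b \<noteq> None \<longrightarrow>
        (\<exists>c\<in>carrier A. \<exists>d\<in>carrier A. padd A a b = padd A c a \<and> padd A a b = padd A b d)) \<and>
     (\<forall>a\<in>carrier A. \<forall>b\<in>carrier A. \<forall>c\<in>carrier A.
        padd A a b \<noteq> None \<and> padd A a b = padd A a c \<longrightarrow> b = c) \<and>
     (\<forall>a\<in>carrier A. \<forall>b\<in>carrier A. \<forall>c\<in>carrier A.
        padd A b a \<noteq> None \<and> padd A b a = padd A c a \<longrightarrow> b = c) \<and>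
     (\<forall>a\<in>carrier A. padd A a (pzero A) = Some a \<and> padd A (pzero A) a = Some a) \<and>
     (\<forall>a\<in>carrier A. \<forall>b\<in>carrier A.
        padd A a b = Some (pzero A) \<longrightarrow> a = pzero A \<and> b = pzero A)"

definition ple :: "('a, 'z) partial_algebra_scheme \<Rightarrow> 'a \<Rightarrow> 'a \<Rightarrow> bool" where
  "ple A a b \<longleftrightarrow> (\<exists>c\<in>carrier A. padd A a c = Some b)"

text \<open>\<open>lquot A a b\<close> is \<open>a / b\<close>, and \<open>rquot A b a\<close> is \<open>b\<close> backslash \<open>a\<close>;
  both are meaningful only for \<open>a \<le> b\<close>.\<close>

definition lquot :: "('a, 'z) partial_algebra_scheme \<Rightarrow> 'a \<Rightarrow> 'a \<Rightarrow> 'a" where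
  "lquot A a b = (THE c. c \<in> carrier A \<and> padd A a c = Some b)"

definition rquot :: "('a, 'z) partial_algebra_scheme \<Rightarrow> 'a \<Rightarrow> 'a \<Rightarrow> 'a" where
  "rquot A b a = (THE d. d \<in> carrier A \<and> padd A d a = Some b)"

definition pea :: "('a, 'z) unital_partial_algebra_scheme \<Rightarrow> bool" where
  "pea A \<longleftrightarrow> gpea A \<and> pone A \<in> carrier A \<and> (\<forall>a\<in>carrier A. ple A a (pone A))"

definition pea_morphism ::
  "('a, 'y) unital_partial_algebra_scheme \<Rightarrow> ('b, 'z) unital_partial_algebra_scheme
    \<Rightarrow> ('a \<Rightarrow> 'b) \<Rightarrow> bool" where
  "pea_morphism A B f \<longleftrightarrow>
     pea A \<and> pea B \<and> f \<in> carrier A \<rightarrow> carrier B \<and>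
     (\<forall>a\<in>carrier A. \<forall>b\<in>carrier A. \<forall>c.
        padd A a b = Some c \<longrightarrow> padd B (f a) (f b) = Some (f c)) \<and>
     f (pone A) = pone B"

definition pea_isomorphism ::
  "('a, 'y) unital_partial_algebra_scheme \<Rightarrow> ('b, 'z) unital_partial_algebra_scheme
    \<Rightarrow> ('a \<Rightarrow> 'b) \<Rightarrow> bool" where
  "pea_isomorphism A B f \<longleftrightarrow>
     bij_betw f (carrier A) (carrier B) \<and>
     pea_morphism A B f \<and> pea_morphism B A (inv_into (carrier A) f)"

text \<open>Isomorphism of partial algebras with zero and unit: sums exist on one side iff they exist
  on the other, and correspond to each other.\<close>

definition partial_isomorphism ::
  "('a, 'y) unital_partial_algebra_scheme \<Rightarrow> ('b, 'z) unital_partial_algebra_scheme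
    \<Rightarrow> ('a \<Rightarrow> 'b) \<Rightarrow> bool" where
  "partial_isomorphism A B f \<longleftrightarrow>
     bij_betw f (carrier A) (carrier B) \<and>
     (\<forall>a\<in>carrier A. \<forall>b\<in>carrier A. padd B (f a) (f b) = map_option f (padd A a b)) \<and>
     f (pzero A) = pzero B \<and> f (pone A) = pone B"

text \<open>Families indexed by \<open>I\<close> are extensional functions, so \<open>I \<rightarrow>\<^sub>E carrier P\<close> is \<open>P\<^sup>I\<close>.
  Below, \<open>E\<close> is the disjoint copy of \<open>carrier P\<close> under the bijection \<open>eta\<close>.\<close>

definition eta_tuple :: "('a \<Rightarrow> 'a) \<Rightarrow> 'i set \<Rightarrow> ('i \<Rightarrow> 'a) \<Rightarrow> ('i \<Rightarrow> 'a)" where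
  "eta_tuple eta I a = (\<lambda>i\<in>I. eta (a i))"

definition uneta_tuple ::
  "('a, 'z) partial_algebra_scheme \<Rightarrow> ('a \<Rightarrow> 'a) \<Rightarrow> 'i set \<Rightarrow> ('i \<Rightarrow> 'a) \<Rightarrow> ('i \<Rightarrow> 'a)" where
  "uneta_tuple P eta I x = (\<lambda>i\<in>I. inv_into (carrier P) eta (x i))"

definition tuple_add ::
  "('a, 'z) partial_algebra_scheme \<Rightarrow> 'i set \<Rightarrow> ('i \<Rightarrow> 'a) \<Rightarrow> ('i \<Rightarrow> 'a) \<Rightarrow> ('i \<Rightarrow> 'a) option" where
  "tuple_add P I a b =
     (if \<forall>i\<in>I. padd P (a i) (b i) \<noteq> None
      then Some (\<lambda>i\<in>I. the (padd P (a i) (b i))) else None)"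

definition kite_add ::
  "('a, 'z) partial_algebra_scheme \<Rightarrow> 'a set \<Rightarrow> ('a \<Rightarrow> 'a) \<Rightarrow> 'i set \<Rightarrow> ('i \<Rightarrow> 'i) \<Rightarrow> ('i \<Rightarrow> 'i)
    \<Rightarrow> ('i \<Rightarrow> 'a) \<Rightarrow> ('i \<Rightarrow> 'a) \<Rightarrow> ('i \<Rightarrow> 'a) option" where
  "kite_add P E eta I lam rho x y =
     (if x \<in> (I \<rightarrow>\<^sub>E carrier P) \<and> y \<in> (I \<rightarrow>\<^sub>E carrier P) then tuple_add P I x y
      else if x \<in> (I \<rightarrow>\<^sub>E carrier P) \<and> y \<in> (I \<rightarrow>\<^sub>E E) then
        (let b = uneta_tuple P eta I y in
         if \<forall>i\<in>I. ple P (x (lam i)) (b i)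
         then Some (eta_tuple eta I (\<lambda>i\<in>I. rquot P (b i) (x (lam i)))) else None)
      else if x \<in> (I \<rightarrow>\<^sub>E E) \<and> y \<in> (I \<rightarrow>\<^sub>E carrier P) then
        (let a = uneta_tuple P eta I x in
         if \<forall>i\<in>I. ple P (y (rho i)) (a i)
         then Some (eta_tuple eta I (\<lambda>i\<in>I. lquot P (y (rho i)) (a i))) else None)
      else None)"

definition kite ::
  "('a, 'z) partial_algebra_scheme \<Rightarrow> 'a set \<Rightarrow> ('a \<Rightarrow> 'a) \<Rightarrow> 'i set \<Rightarrow> ('i \<Rightarrow> 'i) \<Rightarrow> ('i \<Rightarrow> 'i)
    \<Rightarrow> ('i \<Rightarrow> 'a) unital_partial_algebra" where
  "kite P E eta I lam rho =
     \<lparr> carrier = (I \<rightarrow>\<^sub>E carrier P) \<union> (I \<rightarrow>\<^sub>E E),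
       padd = kite_add P E eta I lam rho,
       pzero = (\<lambda>i\<in>I. pzero P),
       pone = (\<lambda>i\<in>I. eta (pzero P)) \<rparr>"

text \<open>The partial algebra \<open>K\<close> is called the kite algebra when it is a PEA.\<close>

definition is_kite_algebra ::
  "('a, 'z) partial_algebra_scheme \<Rightarrow> 'a set \<Rightarrow> ('a \<Rightarrow> 'a) \<Rightarrow> 'i set \<Rightarrow> ('i \<Rightarrow> 'i) \<Rightarrow> ('i \<Rightarrow> 'i)
    \<Rightarrow> bool" where
  "is_kite_algebra P E eta I lam rho \<longleftrightarrow> pea (kite P E eta I lam rho)"

definition KCI ::
  "('a, 'z) partial_algebra_scheme \<Rightarrow> 'i set \<Rightarrow> ('i \<Rightarrow> 'i) \<Rightarrow> ('i \<Rightarrow> 'i) \<Rightarrow> bool" where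
  "KCI P I lam rho \<longleftrightarrow>
     (\<forall>a \<in> I \<rightarrow>\<^sub>E carrier P. \<forall>b \<in> I \<rightarrow>\<^sub>E carrier P. \<forall>i\<in>I.
        padd P (a (rho i)) (b i) \<noteq> None \<longleftrightarrow> padd P (b i) (a (lam i)) \<noteq> None)"

definition kite_gamma ::
  "'i set \<Rightarrow> ('i \<Rightarrow> 'i) \<Rightarrow> ('i \<Rightarrow> 'i) \<Rightarrow> ('i \<Rightarrow> 'a) \<Rightarrow> ('i \<Rightarrow> 'a)" where
  "kite_gamma I lam rho a = (\<lambda>i\<in>I. a (rho (inv_into I lam i)))"

text \<open>The \<open>g\<close>-unitization of \<open>P\<^sup>I\<close>, for a unitizing automorphism \<open>g\<close> of \<open>P\<^sup>I\<close>; it is used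
  with \<open>g = kite_gamma I lam rho\<close>, for which \<open>g y i\<close> is the coordinate of \<open>y\<close> at
  \<open>rho (lam\<^sup>-\<^sup>1 i)\<close>.\<close>

definition unitization_add ::
  "('a, 'z) partial_algebra_scheme \<Rightarrow> 'a set \<Rightarrow> ('a \<Rightarrow> 'a) \<Rightarrow> 'i set
    \<Rightarrow> (('i \<Rightarrow> 'a) \<Rightarrow> ('i \<Rightarrow> 'a))
    \<Rightarrow> ('i \<Rightarrow> 'a) \<Rightarrow> ('i \<Rightarrow> 'a) \<Rightarrow> ('i \<Rightarrow> 'a) option" where
  "unitization_add P E eta I g x y =
     (if x \<in> (I \<rightarrow>\<^sub>E carrier P) \<and> y \<in> (I \<rightarrow>\<^sub>E carrier P) then tuple_add P I x y
      else if x \<in> (I \<rightarrow>\<^sub>E carrier P) \<and> y \<in> (I \<rightarrow>\<^sub>E E) then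
        (let b = uneta_tuple P eta I y in
         if \<forall>i\<in>I. ple P (x i) (b i)
         then Some (eta_tuple eta I (\<lambda>i\<in>I. rquot P (b i) (x i))) else None)
      else if x \<in> (I \<rightarrow>\<^sub>E E) \<and> y \<in> (I \<rightarrow>\<^sub>E carrier P) then
        (let a = uneta_tuple P eta I x in
         if \<forall>i\<in>I. ple P (g y i) (a i)
         then Some (eta_tuple eta I (\<lambda>i\<in>I. lquot P (g y i) (a i))) else None)
      else None)"

definition power_unitization ::
  "('a, 'z) partial_algebra_scheme \<Rightarrow> 'a set \<Rightarrow> ('a \<Rightarrow> 'a) \<Rightarrow> 'i set
    \<Rightarrow> (('i \<Rightarrow> 'a) \<Rightarrow> ('i \<Rightarrow> 'a)) \<Rightarrow> ('i \<Rightarrow> 'a) unital_partial_algebra" where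
  "power_unitization P E eta I g =
     \<lparr> carrier = (I \<rightarrow>\<^sub>E carrier P) \<union> (I \<rightarrow>\<^sub>E E),
       padd = unitization_add P E eta I g,
       pzero = (\<lambda>i\<in>I. pzero P),
       pone = (\<lambda>i\<in>I. eta (pzero P)) \<rparr>"

definition kite_phi ::
  "('a, 'z) partial_algebra_scheme \<Rightarrow> ('a \<Rightarrow> 'a) \<Rightarrow> 'i set \<Rightarrow> ('i \<Rightarrow> 'i) \<Rightarrow> ('i \<Rightarrow> 'a) \<Rightarrow> ('i \<Rightarrow> 'a)"
  where
  "kite_phi P eta I lam x =
     (if x \<in> (I \<rightarrow>\<^sub>E carrier P) then x
      else (let a = uneta_tuple P eta I x in eta_tuple eta I (\<lambda>i\<in>I. a (lam i))))"

end

theory Submission imports Defs begin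

text \<open>Write \<open>\<eta>a\<close> for the elements of the second half of the kite. The subtractions in the
  definition of the sum disappear when sums are read as ternary relations on the power \<open>P\<^sup>I\<close>:
  \<open>a + \<eta>b = \<eta>c\<close> iff \<open>c \<oplus> l a = b\<close>, and \<open>\<eta>a + b = \<eta>c\<close> iff \<open>r b \<oplus> c = a\<close>, where \<open>l\<close> and \<open>r\<close>
  are the automorphisms of \<open>P\<^sup>I\<close> that reindex along \<open>\<lambda>\<close> and \<open>\<rho>\<close>. In this form every PEA axiom for
  the kite is an instance of an axiom for \<open>P\<^sup>I\<close>, except for the conjugation axiom, which uses that
  \<open>r x \<oplus> y\<close> exists iff \<open>y \<oplus> l x\<close> exists, i.e. (KCI). The unitization \<open>U\<close> is the kite for the
  bijections \<open>id\<close> and \<open>\<rho> \<circ> \<lambda>\<^sup>-\<^sup>1\<close>, so it is covered by the same argument. A morphism \<open>\<psi>\<close> that is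
  the identity on \<open>P\<^sup>I\<close> is determined on \<open>\<eta>a\<close> by cancellation in \<open>a + \<psi>(\<eta>a) = 1\<close>.\<close>

section \<open>Generalized pseudo-effect algebras\<close>

lemma option_eqI: "(\<And>w. x = Some w \<longleftrightarrow> y = Some w) \<Longrightarrow> x = y"
  by (metis not_Some_eq)

text \<open>Every axiom is phrased through \<open>= Some\<close>, matching sums that are known only
  as ternary relations. Associativity becomes an equivalence between two ways of reaching
  \<open>w\<close>, and the two conjugation witnesses are asked for separately.\<close>

lemma gpeaI:
  assumes "pzero A \<in> carrier A"
    and "\<And>a b c. \<lbrakk>a \<in> carrier A; b \<in> carrier A; padd A a b = Some c\<rbrakk> \<Longrightarrow> c \<in> carrier A"
    and assoc: "\<And>a b c w. \<lbrakk>a \<in> carrier A; b \<in> carrier A; c \<in> carrier A\<rbrakk> \<Longrightarrow>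
      (\<exists>s. padd A a b = Some s \<and> padd A s c = Some w) \<longleftrightarrow>
      (\<exists>t. padd A b c = Some t \<and> padd A a t = Some w)"
    and conj: "\<And>a b s. \<lbrakk>a \<in> carrier A; b \<in> carrier A; padd A a b = Some s\<rbrakk> \<Longrightarrow>
      (\<exists>c\<in>carrier A. padd A c a = Some s) \<and> (\<exists>d\<in>carrier A. padd A b d = Some s)"
    and cancel_left: "\<And>a b c s. \<lbrakk>a \<in> carrier A; b \<in> carrier A; c \<in> carrier A;
      padd A a b = Some s; padd A a c = Some s\<rbrakk> \<Longrightarrow> b = c"
    and cancel_right: "\<And>a b c s. \<lbrakk>a \<in> carrier A; b \<in> carrier A; c \<in> carrier A;
      padd A b a = Some s; padd A c a = Some s\<rbrakk> \<Longrightarrow> b = c"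
    and "\<And>a. a \<in> carrier A \<Longrightarrow> padd A a (pzero A) = Some a"
    and "\<And>a. a \<in> carrier A \<Longrightarrow> padd A (pzero A) a = Some a"
    and "\<And>a b. \<lbrakk>a \<in> carrier A; b \<in> carrier A; padd A a b = Some (pzero A)\<rbrakk> \<Longrightarrow>
      a = pzero A \<and> b = pzero A"
  shows "gpea A"
proof -
  have 1: "Option.bind (padd A a b) (\<lambda>s. padd A s c) = Option.bind (padd A b c) (\<lambda>s. padd A a s)"
    if "a \<in> carrier A" "b \<in> carrier A" "c \<in> carrier A" for a b c
    by (rule option_eqI) (simp add: bind_eq_Some_conv assoc[OF that])
  have 2: "\<exists>c\<in>carrier A. \<exists>d\<in>carrier A. padd A a b = padd A c a \<and> padd A a b = padd A b d"
    if "a \<in> carrier A" "b \<in> carrier A" "padd A a b \<noteq> None" for a b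
    using conj[OF that(1,2)] that(3) by force
  have 3: "b = c" if "a \<in> carrier A" "b \<in> carrier A" "c \<in> carrier A"
    "padd A a b \<noteq> None \<and> padd A a b = padd A a c" for a b c
    using cancel_left[OF that(1-3)] that(4) by force
  have 4: "b = c" if "a \<in> carrier A" "b \<in> carrier A" "c \<in> carrier A"
    "padd A b a \<noteq> None \<and> padd A b a = padd A c a" for a b c
    using cancel_right[OF that(1-3)] that(4) by force
  show ?thesis
    unfolding gpea_def
    by (intro conjI; (intro ballI allI impI)?;
        rule assms(1,2) 1 2 3 4 conjI[OF assms(7,8)] assms(9); assumption)
qed

context
  fixes A :: "('a, 'z) partial_algebra_scheme"
  assumes A: "gpea A"
begin

lemma gpea_zero: "pzero A \<in> carrier A"
  using A unfolding gpea_def by blast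

lemma gpea_closed: "\<lbrakk>a \<in> carrier A; b \<in> carrier A; padd A a b = Some c\<rbrakk> \<Longrightarrow> c \<in> carrier A"
  using A unfolding gpea_def by blast

lemma gpea_assoc:
  assumes "a \<in> carrier A" "b \<in> carrier A" "c \<in> carrier A"
  shows "(\<exists>s. padd A a b = Some s \<and> padd A s c = Some w) \<longleftrightarrow>
    (\<exists>t. padd A b c = Some t \<and> padd A a t = Some w)"
proof -
  have "Option.bind (padd A a b) (\<lambda>s. padd A s c) = Option.bind (padd A b c) (\<lambda>s. padd A a s)"
    using A assms unfolding gpea_def by blast
  then show ?thesis by (simp add: bind_eq_Some_conv[symmetric])
qed

lemma gpea_conj_left:
  assumes "a \<in> carrier A" "b \<in> carrier A" "padd A a b = Some s"
  obtains c where "c \<in> carrier A" "padd A c a = Some s"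
  using A assms unfolding gpea_def by (metis option.distinct(1))

lemma gpea_conj_right:
  assumes "a \<in> carrier A" "b \<in> carrier A" "padd A a b = Some s"
  obtains d where "d \<in> carrier A" "padd A b d = Some s"
  using A assms unfolding gpea_def by (metis option.distinct(1))

lemma gpea_cancel_left:
  "\<lbrakk>a \<in> carrier A; b \<in> carrier A; c \<in> carrier A; padd A a b = Some s; padd A a c = Some s\<rbrakk>
    \<Longrightarrow> b = c"
  using A unfolding gpea_def by (metis option.distinct(1))

lemma gpea_cancel_right:
  "\<lbrakk>a \<in> carrier A; b \<in> carrier A; c \<in> carrier A; padd A b a = Some s; padd A c a = Some s\<rbrakk>
    \<Longrightarrow> b = c"
  using A unfolding gpea_def by (metis option.distinct(1))

lemma gpea_add_zero: "a \<in> carrier A \<Longrightarrow> padd A a (pzero A) = Some a"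
  using A unfolding gpea_def by blast

lemma gpea_zero_add: "a \<in> carrier A \<Longrightarrow> padd A (pzero A) a = Some a"
  using A unfolding gpea_def by blast

lemma gpea_positive:
  "\<lbrakk>a \<in> carrier A; b \<in> carrier A; padd A a b = Some (pzero A)\<rbrakk> \<Longrightarrow> a = pzero A \<and> b = pzero A"
  using A unfolding gpea_def by blast

text \<open>Conjugation trades a right complement of \<open>a\<close> in \<open>b\<close> for a left
  one and back. This is what makes \<open>rquot\<close> meaningful although \<open>ple\<close>
  speaks of right complements only.\<close>

lemma ple_iff_left: "a \<in> carrier A \<Longrightarrow> ple A a b \<longleftrightarrow> (\<exists>d\<in>carrier A. padd A d a = Some b)"
  unfolding ple_def by (metis gpea_conj_left gpea_conj_right)

text \<open>Cancellation makes the described element unique, so any witness of the sum is the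
  quotient.\<close>

lemma lquot_eq:
  "\<lbrakk>a \<in> carrier A; c \<in> carrier A; padd A a c = Some b\<rbrakk> \<Longrightarrow> lquot A a b = c"
  unfolding lquot_def by (rule the_equality) (auto intro: gpea_cancel_left)

lemma rquot_eq:
  "\<lbrakk>a \<in> carrier A; d \<in> carrier A; padd A d a = Some b\<rbrakk> \<Longrightarrow> rquot A b a = d"
  unfolding rquot_def by (rule the_equality) (auto intro: gpea_cancel_right)

end

text \<open>Since \<open>f\<close> reflects the existence of sums, a sum in \<open>B\<close> pulls
  back to a sum in \<open>A\<close>, so the inverse is a morphism as well.\<close>

lemma partial_isomorphism_imp_pea_isomorphism:
  assumes f: "partial_isomorphism A B f" and "pea A" "pea B"
  shows "pea_isomorphism A B f"
proof -
  let ?h = "inv_into (carrier A) f"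
  have bij: "bij_betw f (carrier A) (carrier B)"
    and add: "\<And>a b. \<lbrakk>a \<in> carrier A; b \<in> carrier A\<rbrakk> \<Longrightarrow>
      padd B (f a) (f b) = map_option f (padd A a b)"
    and one: "f (pone A) = pone B"
    using f unfolding partial_isomorphism_def by blast+
  have hf: "?h (f a) = a" if "a \<in> carrier A" for a
    using bij that by (rule bij_betw_inv_into_left)
  have fh: "f (?h b) = b" if "b \<in> carrier B" for b
    using bij that by (rule bij_betw_inv_into_right)
  have h: "?h b \<in> carrier A" if "b \<in> carrier B" for b
    using bij that by (meson bij_betw_inv_into bij_betwE)
  have oneA: "pone A \<in> carrier A" and gA: "gpea A"
    using \<open>pea A\<close> unfolding pea_def by blast+
  have "padd A (?h x) (?h y) = Some (?h z)"
    if xy: "x \<in> carrier B" "y \<in> carrier B" and xyz: "padd B x y = Some z" for x y z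
  proof -
    have "map_option f (padd A (?h x) (?h y)) = Some z"
      using add[OF h h, OF xy] fh xy xyz by simp
    \<comment> \<open>Closure puts \<open>w\<close> in the carrier of \<open>A\<close>, where the
      inverse sends \<open>f w\<close> back to \<open>w\<close>.\<close>
    then obtain w where w: "padd A (?h x) (?h y) = Some w" "z = f w" by blast
    then show ?thesis using hf gpea_closed[OF gA h h, OF xy] by simp
  qed
  moreover have "?h (pone B) = pone A" using hf[OF oneA] one by simp
  moreover have "f \<in> carrier A \<rightarrow> carrier B" using bij by (auto dest: bij_betwE)
  ultimately show ?thesis
    unfolding pea_isomorphism_def pea_morphism_def
    using assms(2,3) bij add one h by auto
qed

text \<open>The \<open>\<eta>\<close>-half of the carrier carries two twists \<open>l\<close> and \<open>r\<close>; for \<open>l = id\<close> this is the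
  \<open>r\<close>-unitization.\<close>

lemma pea_of_twisted_double:
  fixes G :: "('a, 'y) partial_algebra_scheme" and A :: "('a, 'z) unital_partial_algebra_scheme"
  assumes G: "gpea G"
    and l_add: "\<And>a b c. \<lbrakk>a \<in> carrier G; b \<in> carrier G; c \<in> carrier G\<rbrakk> \<Longrightarrow>
      padd G (l a) (l b) = Some (l c) \<longleftrightarrow> padd G a b = Some c"
    and l_bij: "bij_betw l (carrier G) (carrier G)"
    and r_bij: "bij_betw r (carrier G) (carrier G)"
    and r_add: "\<And>a b c. \<lbrakk>a \<in> carrier G; b \<in> carrier G; c \<in> carrier G\<rbrakk> \<Longrightarrow>
      padd G (r a) (r b) = Some (r c) \<longleftrightarrow> padd G a b = Some c"
    and twist: "\<And>a b. \<lbrakk>a \<in> carrier G; b \<in> carrier G\<rbrakk> \<Longrightarrow>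
      padd G (r a) b \<noteq> None \<longleftrightarrow> padd G b (l a) \<noteq> None"
    and e_inj: "inj_on e (carrier G)"
    and disj: "carrier G \<inter> e ` carrier G = {}"
    and carr: "carrier A = carrier G \<union> e ` carrier G"
    and zero: "pzero A = pzero G" and one: "pone A = e (pzero G)"
    and A1: "\<And>a b. \<lbrakk>a \<in> carrier G; b \<in> carrier G\<rbrakk> \<Longrightarrow> padd A a b = padd G a b"
    and A2: "\<And>a b z. \<lbrakk>a \<in> carrier G; b \<in> carrier G\<rbrakk> \<Longrightarrow>
      padd A a (e b) = Some z \<longleftrightarrow> (\<exists>c\<in>carrier G. z = e c \<and> padd G c (l a) = Some b)"
    and A3: "\<And>a b z. \<lbrakk>a \<in> carrier G; b \<in> carrier G\<rbrakk> \<Longrightarrow>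
      padd A (e a) b = Some z \<longleftrightarrow> (\<exists>c\<in>carrier G. z = e c \<and> padd G (r b) c = Some a)"
    and A4: "\<And>a b. \<lbrakk>a \<in> carrier G; b \<in> carrier G\<rbrakk> \<Longrightarrow> padd A (e a) (e b) = None"
  shows "pea A"
proof -
  let ?C = "carrier G"
  have lC: "l a \<in> ?C" and rC: "r a \<in> ?C" if "a \<in> ?C" for a
    using l_bij r_bij that by (auto dest: bij_betwE)
  have l_sur: "\<exists>a\<in>?C. l a = b" and r_sur: "\<exists>a\<in>?C. r a = b" if "b \<in> ?C" for b
    using l_bij r_bij that by (metis bij_betw_imp_surj_on imageE)+
  have l_inj: "a = b" if "l a = l b" "a \<in> ?C" "b \<in> ?C" for a b
    using l_bij that by (meson bij_betw_imp_inj_on inj_onD)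
  have r_inj: "a = b" if "r a = r b" "a \<in> ?C" "b \<in> ?C" for a b
    using r_bij that by (meson bij_betw_imp_inj_on inj_onD)
  have e_eq: "e a = e b \<longleftrightarrow> a = b" if "a \<in> ?C" "b \<in> ?C" for a b
    using e_inj that by (auto dest: inj_onD)
  have e_notin: "e a \<noteq> b" if "a \<in> ?C" "b \<in> ?C" for a b
    using disj that by blast
  note closed = gpea_closed[OF G]
  note z = gpea_zero[OF G]
  \<comment> \<open>\<open>l 0 \<oplus> l 0 = l 0 = l 0 \<oplus> 0\<close>, so cancellation gives
    \<open>l 0 = 0\<close>; likewise for \<open>r\<close>.\<close>
  have l0: "l (pzero G) = pzero G" and r0: "r (pzero G) = pzero G"
    using gpea_cancel_left[OF G lC[OF z] lC[OF z] z] gpea_cancel_left[OF G rC[OF z] rC[OF z] z]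
      l_add[OF z z z] r_add[OF z z z] gpea_add_zero[OF G] z lC rC by simp_all
  \<comment> \<open>These three facts turn an intermediate sum in \<open>A\<close> into a quantifier
    over the carrier of \<open>G\<close>, so that iterated sums in \<open>A\<close> become
    statements about \<open>G\<close> alone.\<close>
  have bind1: "(\<exists>s. padd A a b = Some s \<and> Q s) \<longleftrightarrow> (\<exists>s\<in>?C. padd G a b = Some s \<and> Q s)"
    if "a \<in> ?C" "b \<in> ?C" for a b Q
    using A1[OF that] closed[OF that] by auto
  have bind2: "(\<exists>s. padd A a (e b) = Some s \<and> Q s) \<longleftrightarrow>
      (\<exists>c\<in>?C. padd G c (l a) = Some b \<and> Q (e c))" if "a \<in> ?C" "b \<in> ?C" for a b Q
    using A2[OF that] by auto
  have bind3: "(\<exists>s. padd A (e a) b = Some s \<and> Q s) \<longleftrightarrow>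
      (\<exists>c\<in>?C. padd G (r b) c = Some a \<and> Q (e c))" if "a \<in> ?C" "b \<in> ?C" for a b Q
    using A3[OF that] by auto
  have no_sum: "padd G a b \<noteq> Some (e c)" if "a \<in> ?C" "b \<in> ?C" "c \<in> ?C" for a b c
    using closed[OF that(1,2)] e_notin that by blast
  note binds = bind1 bind2 bind3
  note sums = A1 A2 A3 A4 no_sum
  have assocG: "(\<exists>s\<in>?C. padd G a b = Some s \<and> padd G s c = Some w) \<longleftrightarrow>
      (\<exists>t\<in>?C. padd G b c = Some t \<and> padd G a t = Some w)"
    if "a \<in> ?C" "b \<in> ?C" "c \<in> ?C" for a b c w
    using gpea_assoc[OF G that, of w] closed that by blast
  \<comment> \<open>By surjectivity of \<open>l\<close>, the sum of \<open>l a\<close> and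
    \<open>l b\<close>, if it exists, has the form \<open>l s\<close>; \<open>l_add\<close> then
    identifies \<open>s\<close> with the sum of \<open>a\<close> and \<open>b\<close>. The same
    holds for \<open>r\<close>.\<close>
  have bind_l: "(\<exists>s\<in>?C. padd G a b = Some s \<and> Q (l s)) \<longleftrightarrow>
      (\<exists>s\<in>?C. padd G (l a) (l b) = Some s \<and> Q s)" if "a \<in> ?C" "b \<in> ?C" for a b Q
    using l_add[OF that] l_sur lC by metis
  have bind_r: "(\<exists>s\<in>?C. padd G a b = Some s \<and> Q (r s)) \<longleftrightarrow>
      (\<exists>s\<in>?C. padd G (r a) (r b) = Some s \<and> Q s)" if "a \<in> ?C" "b \<in> ?C" for a b Q
    using r_add[OF that] r_sur rC by metis
  have split: "thesis" if "x \<in> carrier A" "x \<in> ?C \<Longrightarrow> thesis"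
    "\<And>a. a \<in> ?C \<Longrightarrow> x = e a \<Longrightarrow> thesis" for x thesis
    using that unfolding carr by blast
  have twist_lr: "\<exists>d\<in>?C. padd G b (l a) = Some d"
    if "padd G (r a) b = Some s" "a \<in> ?C" "b \<in> ?C" for a b s
    using twist[OF that(2,3)] that closed lC by (metis option.distinct(1) option.exhaust)
  have twist_rl: "\<exists>d\<in>?C. padd G (r a) b = Some d"
    if "padd G b (l a) = Some s" "a \<in> ?C" "b \<in> ?C" for a b s
    using twist[OF that(2,3)] that closed rC by (metis option.distinct(1) option.exhaust)
  have "gpea A"
  proof (rule gpeaI)
    show "pzero A \<in> carrier A" using z zero carr by simp
  next
    fix x y w assume "x \<in> carrier A" "y \<in> carrier A" "padd A x y = Some w"
    then show "w \<in> carrier A"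
      by (elim split) (auto simp: sums carr intro: closed)
  next
    \<comment> \<open>With two or more summands from the \<open>e\<close>-half both sides are
      undefined, so only the cases with at most one such summand carry content. Below,
      \<open>e u\<close> is the value of the triple sum.\<close>
    fix x y v w assume "x \<in> carrier A" "y \<in> carrier A" "v \<in> carrier A"
    then show "(\<exists>s. padd A x y = Some s \<and> padd A s v = Some w) \<longleftrightarrow>
      (\<exists>t. padd A y v = Some t \<and> padd A x t = Some w)" (is "?thesis")
    proof (elim split)
      assume "x \<in> ?C" "y \<in> ?C" "v \<in> ?C"
      then show ?thesis by (simp add: binds) (simp add: sums assocG cong: bex_cong)
    next
      fix c assume abc: "x \<in> ?C" "y \<in> ?C" "c \<in> ?C" "v = e c"
      \<comment> \<open>Both bracketings say that \<open>c\<close> is the sum of \<open>u\<close>,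
        \<open>l x\<close>, \<open>l y\<close> in this order.\<close>
      have "(\<exists>s\<in>?C. padd G x y = Some s \<and> padd G u (l s) = Some c) \<longleftrightarrow>
          (\<exists>t\<in>?C. padd G t (l y) = Some c \<and> padd G u (l x) = Some t)" if "u \<in> ?C" for u
        using assocG[OF that lC lC, of x y c] bind_l[of x y "\<lambda>s. padd G u s = Some c"] abc by auto
      then show ?thesis using abc by (simp add: binds) (simp add: sums cong: bex_cong, blast)
    next
      fix b assume abc: "x \<in> ?C" "b \<in> ?C" "y = e b" "v \<in> ?C"
      \<comment> \<open>Both bracketings say that \<open>b\<close> is the sum of \<open>r v\<close>,
        \<open>u\<close>, \<open>l x\<close> in this order.\<close>
      have "(\<exists>s\<in>?C. padd G s (l x) = Some b \<and> padd G (r v) u = Some s) \<longleftrightarrow>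
          (\<exists>t\<in>?C. padd G (r v) t = Some b \<and> padd G u (l x) = Some t)" if "u \<in> ?C" for u
        using assocG[OF rC that lC, of v x b] abc by auto
      then show ?thesis using abc by (simp add: binds) (simp add: sums cong: bex_cong, blast)
    next
      fix a assume abc: "a \<in> ?C" "x = e a" "y \<in> ?C" "v \<in> ?C"
      \<comment> \<open>Both bracketings say that \<open>a\<close> is the sum of \<open>r y\<close>,
        \<open>r v\<close>, \<open>u\<close> in this order.\<close>
      have "(\<exists>s\<in>?C. padd G (r y) s = Some a \<and> padd G (r v) u = Some s) \<longleftrightarrow>
          (\<exists>t\<in>?C. padd G y v = Some t \<and> padd G (r t) u = Some a)" if "u \<in> ?C" for u
        using assocG[OF rC rC that, of y v a] bind_r[of y v "\<lambda>s. padd G s u = Some a"] abc by auto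
      then show ?thesis using abc by (simp add: binds) (simp add: sums cong: bex_cong, blast)
    qed (auto simp: sums)
  next
    fix x y w assume "x \<in> carrier A" "y \<in> carrier A" "padd A x y = Some w"
    then show "(\<exists>u\<in>carrier A. padd A u x = Some w) \<and> (\<exists>u\<in>carrier A. padd A y u = Some w)"
    proof (elim split)
      assume "x \<in> ?C" "y \<in> ?C" "padd A x y = Some w"
      then show ?thesis
        by (simp add: sums carr bex_Un) (metis A1 gpea_conj_left[OF G] gpea_conj_right[OF G])
    next
      fix b assume b: "x \<in> ?C" "b \<in> ?C" "y = e b" "padd A x y = Some w"
      then obtain c where c: "c \<in> ?C" "w = e c" "padd G c (l x) = Some b" by (auto simp: sums)
      \<comment> \<open>The equation \<open>e d + x = e c\<close> means
        \<open>r x \<oplus> c = d\<close>. That sum exists by the twist condition because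
        \<open>c \<oplus> l x\<close> does.\<close>
      obtain d where d: "d \<in> ?C" "padd G (r x) c = Some d" using twist_rl c b by blast
      \<comment> \<open>The equation \<open>e b + v = e c\<close> means
        \<open>r v \<oplus> c = b\<close>, so \<open>v\<close> is the preimage under
        \<open>r\<close> of a left complement of \<open>c\<close> in \<open>b\<close>.\<close>
      obtain u where "u \<in> ?C" "padd G u c = Some b"
        using gpea_conj_left[OF G c(1) lC c(3)] b by blast
      then obtain v where v: "v \<in> ?C" "padd G (r v) c = Some b" using r_sur by metis
      have "padd A (e d) x = Some w" "padd A y v = Some w"
        using b c d v by (auto simp: sums)
      then show ?thesis using d v carr by blast
    next
      fix a assume a: "a \<in> ?C" "x = e a" "y \<in> ?C" "padd A x y = Some w"
      then obtain c where c: "c \<in> ?C" "w = e c" "padd G (r y) c = Some a" by (auto simp: sums)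
      \<comment> \<open>This mirrors the previous case: \<open>y + e d = e c\<close> means
        \<open>c \<oplus> l y = d\<close>, and \<open>v + e a = e c\<close> means
        \<open>c \<oplus> l v = a\<close>.\<close>
      obtain d where d: "d \<in> ?C" "padd G c (l y) = Some d" using twist_lr c a by blast
      obtain u where "u \<in> ?C" "padd G c u = Some a"
        using gpea_conj_right[OF G rC c(1) c(3)] a by blast
      then obtain v where v: "v \<in> ?C" "padd G c (l v) = Some a" using l_sur by metis
      have "padd A v x = Some w" "padd A y (e d) = Some w"
        using a c d v by (auto simp: sums)
      then show ?thesis using d v carr by blast
    qed (simp add: sums)
  next
    fix x y v w assume "x \<in> carrier A" "y \<in> carrier A" "v \<in> carrier A"
      "padd A x y = Some w" "padd A x v = Some w"
    then show "y = v"
    proof (elim split)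
      assume "x \<in> ?C" "y \<in> ?C" "v \<in> ?C" "padd A x y = Some w" "padd A x v = Some w"
      then show ?thesis by (simp add: sums) (metis gpea_cancel_left[OF G])
    next
      fix b b' assume *: "x \<in> ?C" "b \<in> ?C" "y = e b" "b' \<in> ?C" "v = e b'"
        "padd A x y = Some w" "padd A x v = Some w"
      then obtain c c' where "c \<in> ?C" "padd G c (l x) = Some b" "w = e c"
        "c' \<in> ?C" "padd G c' (l x) = Some b'" "w = e c'" by (auto simp: sums)
      then show ?thesis using * e_eq by (metis option.inject)
    next
      fix a assume *: "a \<in> ?C" "x = e a" "y \<in> ?C" "v \<in> ?C"
        "padd A x y = Some w" "padd A x v = Some w"
      then obtain c c' where "c \<in> ?C" "padd G (r y) c = Some a" "w = e c"
        "c' \<in> ?C" "padd G (r v) c' = Some a" "w = e c'" by (auto simp: sums)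
      then have "r y = r v"
        using * e_eq gpea_cancel_right[OF G _ rC rC] by metis
      then show ?thesis using * r_inj by blast
    qed (auto simp: sums)
  next
    fix x y v w assume "x \<in> carrier A" "y \<in> carrier A" "v \<in> carrier A"
      "padd A y x = Some w" "padd A v x = Some w"
    then show "y = v"
    proof (elim split)
      assume "x \<in> ?C" "y \<in> ?C" "v \<in> ?C" "padd A y x = Some w" "padd A v x = Some w"
      then show ?thesis by (simp add: sums) (metis gpea_cancel_right[OF G])
    next
      fix b b' assume *: "x \<in> ?C" "b \<in> ?C" "y = e b" "b' \<in> ?C" "v = e b'"
        "padd A y x = Some w" "padd A v x = Some w"
      then obtain c c' where "c \<in> ?C" "padd G (r x) c = Some b" "w = e c"
        "c' \<in> ?C" "padd G (r x) c' = Some b'" "w = e c'" by (auto simp: sums)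
      then show ?thesis using * e_eq by (metis option.inject)
    next
      fix a assume *: "a \<in> ?C" "x = e a" "y \<in> ?C" "v \<in> ?C"
        "padd A y x = Some w" "padd A v x = Some w"
      then obtain c c' where "c \<in> ?C" "padd G c (l y) = Some a" "w = e c"
        "c' \<in> ?C" "padd G c' (l v) = Some a" "w = e c'" by (auto simp: sums)
      then have "l y = l v"
        using * e_eq gpea_cancel_left[OF G _ lC lC] by metis
      then show ?thesis using * l_inj by blast
    qed (auto simp: sums)
  next
    fix x assume "x \<in> carrier A"
    then show "padd A x (pzero A) = Some x"
      by (elim split) (auto simp: sums zero z r0 gpea_add_zero[OF G] gpea_zero_add[OF G])
  next
    fix x assume "x \<in> carrier A"
    then show "padd A (pzero A) x = Some x"
      by (elim split) (auto simp: sums zero z l0 gpea_add_zero[OF G] gpea_zero_add[OF G])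
  next
    fix x y assume "x \<in> carrier A" "y \<in> carrier A" "padd A x y = Some (pzero A)"
    then show "x = pzero A \<and> y = pzero A"
      \<comment> \<open>A sum involving the \<open>e\<close>-half lies in that half and hence is
        never zero, so both summands come from \<open>G\<close>.\<close>
      using gpea_positive[OF G] e_notin[OF _ z, THEN not_sym]
      by (elim split) (auto simp: sums zero)
  qed
  moreover have "ple A x (pone A)" if "x \<in> carrier A" for x
    using that
  proof (elim split)
    assume x: "x \<in> ?C"
    \<comment> \<open>The complement of \<open>x\<close> is \<open>e (l x)\<close>, because
      \<open>0 \<oplus> l x = l x\<close>. For \<open>x = e a\<close> it is the \<open>b\<close>
      with \<open>r b = a\<close>.\<close>
    then have "padd A x (e (l x)) = Some (pone A)"
      using z lC by (auto simp: sums one gpea_zero_add[OF G])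
    then show ?thesis using lC[OF x] carr unfolding ple_def by blast
  next
    fix a assume a: "a \<in> ?C" "x = e a"
    obtain b where "b \<in> ?C" "r b = a" using r_sur[OF a(1)] by blast
    then have "b \<in> carrier A" "padd A x b = Some (pone A)"
      using z a carr by (auto simp: sums one gpea_add_zero[OF G])
    then show ?thesis unfolding ple_def by blast
  qed
  ultimately show ?thesis using z unfolding pea_def by (simp add: one carr)
qed

section \<open>Powers and kites\<close>

definition power_algebra :: "('a, 'z) partial_algebra_scheme \<Rightarrow> 'i set \<Rightarrow> ('i \<Rightarrow> 'a) partial_algebra"
  where "power_algebra P I =
    \<lparr> carrier = I \<rightarrow>\<^sub>E carrier P, padd = tuple_add P I, pzero = (\<lambda>i\<in>I. pzero P) \<rparr>"

lemma power_algebra_simps [simp]: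
  "carrier (power_algebra P I) = (I \<rightarrow>\<^sub>E carrier P)"
  "padd (power_algebra P I) = tuple_add P I"
  "pzero (power_algebra P I) = (\<lambda>i\<in>I. pzero P)"
  by (simp_all add: power_algebra_def)

text \<open>The coordinate equations fix \<open>c\<close> on \<open>I\<close> only; extensionality
  fixes it elsewhere.\<close>

lemma tuple_add_eq_Some:
  "tuple_add P I a b = Some c \<longleftrightarrow>
    c \<in> extensional I \<and> (\<forall>i\<in>I. padd P (a i) (b i) = Some (c i))"
proof
  assume "tuple_add P I a b = Some c"
  then show "c \<in> extensional I \<and> (\<forall>i\<in>I. padd P (a i) (b i) = Some (c i))"
    by (auto simp: tuple_add_def split: if_splits)
next
  assume "c \<in> extensional I \<and> (\<forall>i\<in>I. padd P (a i) (b i) = Some (c i))"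
  then show "tuple_add P I a b = Some c"
    by (auto simp: tuple_add_def extensional_def)
qed

lemma tuple_add_defined: "tuple_add P I a b \<noteq> None \<longleftrightarrow> (\<forall>i\<in>I. padd P (a i) (b i) \<noteq> None)"
  by (simp add: tuple_add_def)

text \<open>Coordinatewise witnesses are assembled into one family, and restricting the choice
  function to \<open>I\<close> makes it extensional.\<close>

lemma PiE_choice:
  assumes "\<forall>i\<in>I. \<exists>x\<in>S. Q i x"
  shows "\<exists>f\<in>I \<rightarrow>\<^sub>E S. \<forall>i\<in>I. Q i (f i)"
proof -
  obtain f where "\<forall>i\<in>I. f i \<in> S \<and> Q i (f i)" using assms by metis
  then have "restrict f I \<in> I \<rightarrow>\<^sub>E S" "\<forall>i\<in>I. Q i (restrict f I i)" by auto
  then show ?thesis by blast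
qed

text \<open>All axioms hold coordinate by coordinate; those asserting existence use choice over
  \<open>I\<close>.\<close>

lemma gpea_power_algebra:
  assumes P: "gpea P"
  shows "gpea (power_algebra P I)"
proof (rule gpeaI, unfold power_algebra_simps tuple_add_eq_Some)
  show "(\<lambda>i\<in>I. pzero P) \<in> I \<rightarrow>\<^sub>E carrier P" using gpea_zero[OF P] by auto
next
  fix a b c assume "a \<in> I \<rightarrow>\<^sub>E carrier P" "b \<in> I \<rightarrow>\<^sub>E carrier P"
    "c \<in> extensional I \<and> (\<forall>i\<in>I. padd P (a i) (b i) = Some (c i))"
  then show "c \<in> I \<rightarrow>\<^sub>E carrier P" by (auto simp: PiE_iff intro: gpea_closed[OF P])
next
  fix a b c w assume abc: "a \<in> I \<rightarrow>\<^sub>E carrier P" "b \<in> I \<rightarrow>\<^sub>E carrier P" "c \<in> I \<rightarrow>\<^sub>E carrier P"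
  have pt: "(\<exists>s. padd P (a i) (b i) = Some s \<and> padd P s (c i) = Some (w i)) \<longleftrightarrow>
      (\<exists>t. padd P (b i) (c i) = Some t \<and> padd P (a i) t = Some (w i))" if "i \<in> I" for i
    using gpea_assoc[OF P] abc that by (simp add: PiE_iff)
  \<comment> \<open>The existence of a family of intermediate sums is reduced to their existence in
    each coordinate. It is instantiated for both bracketings.\<close>
  have ch: "(\<exists>s. (s \<in> extensional I \<and> (\<forall>i\<in>I. f i = Some (s i))) \<and>
        w \<in> extensional I \<and> (\<forall>i\<in>I. g i (s i) = Some (w i))) \<longleftrightarrow>
      w \<in> extensional I \<and> (\<forall>i\<in>I. \<exists>s. f i = Some s \<and> g i s = Some (w i))"
    (is "?L \<longleftrightarrow> ?R") for f :: "_ \<Rightarrow> 'a option" and g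
  proof
    assume ?R
    then have "\<forall>i\<in>I. \<exists>s\<in>UNIV. f i = Some s \<and> g i s = Some (w i)" by blast
    from PiE_choice[OF this] obtain s
      where "s \<in> I \<rightarrow>\<^sub>E UNIV" "\<forall>i\<in>I. f i = Some (s i) \<and> g i (s i) = Some (w i)"
      by blast
    with \<open>?R\<close> show ?L by (auto simp: PiE_iff)
  qed blast
  show "(\<exists>s. (s \<in> extensional I \<and> (\<forall>i\<in>I. padd P (a i) (b i) = Some (s i))) \<and>
      w \<in> extensional I \<and> (\<forall>i\<in>I. padd P (s i) (c i) = Some (w i))) \<longleftrightarrow>
    (\<exists>t. (t \<in> extensional I \<and> (\<forall>i\<in>I. padd P (b i) (c i) = Some (t i))) \<and>
      w \<in> extensional I \<and> (\<forall>i\<in>I. padd P (a i) (t i) = Some (w i)))"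
    unfolding ch[of "\<lambda>i. padd P (a i) (b i)" "\<lambda>i s. padd P s (c i)"]
      ch[of "\<lambda>i. padd P (b i) (c i)" "\<lambda>i. padd P (a i)"]
    by (simp add: pt cong: conj_cong)
next
  fix a b s assume ab: "a \<in> I \<rightarrow>\<^sub>E carrier P" "b \<in> I \<rightarrow>\<^sub>E carrier P"
    and s: "s \<in> extensional I \<and> (\<forall>i\<in>I. padd P (a i) (b i) = Some (s i))"
  have "\<forall>i\<in>I. \<exists>c\<in>carrier P. padd P c (a i) = Some (s i)"
    "\<forall>i\<in>I. \<exists>d\<in>carrier P. padd P (b i) d = Some (s i)"
    using ab s gpea_conj_left[OF P] gpea_conj_right[OF P] by (metis PiE_mem)+
  then show "(\<exists>c\<in>I \<rightarrow>\<^sub>E carrier P. s \<in> extensional I \<and> (\<forall>i\<in>I. padd P (c i) (a i) = Some (s i))) \<and>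
    (\<exists>d\<in>I \<rightarrow>\<^sub>E carrier P. s \<in> extensional I \<and> (\<forall>i\<in>I. padd P (b i) (d i) = Some (s i)))"
    using s by (auto dest!: PiE_choice)
next
  fix a b c s assume "a \<in> I \<rightarrow>\<^sub>E carrier P" "b \<in> I \<rightarrow>\<^sub>E carrier P" "c \<in> I \<rightarrow>\<^sub>E carrier P"
    "s \<in> extensional I \<and> (\<forall>i\<in>I. padd P (a i) (b i) = Some (s i))"
    "s \<in> extensional I \<and> (\<forall>i\<in>I. padd P (a i) (c i) = Some (s i))"
  then show "b = c" by (intro PiE_ext[of b I _ c]) (auto intro: gpea_cancel_left[OF P])
next
  fix a b c s assume "a \<in> I \<rightarrow>\<^sub>E carrier P" "b \<in> I \<rightarrow>\<^sub>E carrier P" "c \<in> I \<rightarrow>\<^sub>E carrier P"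
    "s \<in> extensional I \<and> (\<forall>i\<in>I. padd P (b i) (a i) = Some (s i))"
    "s \<in> extensional I \<and> (\<forall>i\<in>I. padd P (c i) (a i) = Some (s i))"
  then show "b = c" by (intro PiE_ext[of b I _ c]) (auto intro: gpea_cancel_right[OF P])
next
  fix a assume "a \<in> I \<rightarrow>\<^sub>E carrier P"
  then show "a \<in> extensional I \<and> (\<forall>i\<in>I. padd P (a i) ((\<lambda>i\<in>I. pzero P) i) = Some (a i))"
    "a \<in> extensional I \<and> (\<forall>i\<in>I. padd P ((\<lambda>i\<in>I. pzero P) i) (a i) = Some (a i))"
    by (auto simp: PiE_iff gpea_add_zero[OF P] gpea_zero_add[OF P])
next
  fix a b assume ab: "a \<in> I \<rightarrow>\<^sub>E carrier P" "b \<in> I \<rightarrow>\<^sub>E carrier P"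
    and s: "(\<lambda>i\<in>I. pzero P) \<in> extensional I \<and>
      (\<forall>i\<in>I. padd P (a i) (b i) = Some ((\<lambda>i\<in>I. pzero P) i))"
  then have "a i = pzero P \<and> b i = pzero P" if "i \<in> I" for i
    using gpea_positive[OF P, of "a i" "b i"] that by auto
  then show "a = (\<lambda>i\<in>I. pzero P) \<and> b = (\<lambda>i\<in>I. pzero P)"
    using ab by (auto simp: PiE_iff extensional_def fun_eq_iff)
qed

section \<open>Reindexing of families along a permutation of the index set\<close>

definition reindex :: "'i set \<Rightarrow> ('i \<Rightarrow> 'i) \<Rightarrow> ('i \<Rightarrow> 'a) \<Rightarrow> ('i \<Rightarrow> 'a)" where
  "reindex I p a = (\<lambda>i\<in>I. a (p i))"

lemma reindex_apply [simp]: "i \<in> I \<Longrightarrow> reindex I p a i = a (p i)"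
  by (simp add: reindex_def)

lemma reindex_in_PiE:
  "\<lbrakk>p \<in> I \<rightarrow> I; a \<in> I \<rightarrow>\<^sub>E S\<rbrakk> \<Longrightarrow> reindex I p a \<in> I \<rightarrow>\<^sub>E S"
  by (auto simp: reindex_def)

lemma reindex_reindex:
  "\<lbrakk>p \<in> I \<rightarrow> I; q \<in> I \<rightarrow> I; \<And>i. i \<in> I \<Longrightarrow> p (q i) = i; a \<in> extensional I\<rbrakk>
    \<Longrightarrow> reindex I q (reindex I p a) = a"
  by (auto simp: reindex_def extensional_def fun_eq_iff)

lemma bij_betw_reindex:
  assumes p: "bij_betw p I I"
  shows "bij_betw (reindex I p) (I \<rightarrow>\<^sub>E S) (I \<rightarrow>\<^sub>E S)"
proof -
  let ?q = "inv_into I p"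
  have q: "?q \<in> I \<rightarrow> I" and pI: "p \<in> I \<rightarrow> I"
    using p bij_betw_inv_into[OF p] by (auto dest: bij_betwE)
  show ?thesis
    by (rule bij_betw_byWitness[where f' = "reindex I ?q"])
      (auto simp: reindex_reindex[OF pI q] reindex_reindex[OF q pI] PiE_iff
        bij_betw_inv_into_left[OF p] bij_betw_inv_into_right[OF p]
        intro!: reindex_in_PiE[OF pI] reindex_in_PiE[OF q])
qed

text \<open>As \<open>i\<close> runs through \<open>I\<close>, so does \<open>p i\<close>, hence the
  two families of coordinate equations are the same. A reindexed family is always extensional, so
  extensionality of \<open>c\<close> has to be assumed.\<close>

lemma tuple_add_reindex:
  assumes p: "bij_betw p I I" and c: "c \<in> extensional I"
  shows "tuple_add P I (reindex I p a) (reindex I p b) = Some (reindex I p c) \<longleftrightarrow>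
    tuple_add P I a b = Some c"
proof -
  have "(\<forall>i\<in>I. Q (p i)) \<longleftrightarrow> (\<forall>i\<in>I. Q i)" for Q
    using p by (metis bij_betw_iff_bijections)
  from this[of "\<lambda>i. padd P (a i) (b i) = Some (c i)"] show ?thesis
    using c by (simp add: tuple_add_eq_Some) (simp add: reindex_def)
qed

section \<open>The two halves of the kite and its sums as ternary relations on the power\<close>

locale kite_data =
  fixes P :: "'a partial_algebra" and E :: "'a set" and eta :: "'a \<Rightarrow> 'a"
    and I :: "'i set" and lam rho :: "'i \<Rightarrow> 'i"
  assumes P: "gpea P"
    and I: "I \<noteq> {}"
    and lam: "bij_betw lam I I" and rho: "bij_betw rho I I"
    and disj: "carrier P \<inter> E = {}" and eta: "bij_betw eta (carrier P) E"
begin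

abbreviation "PI \<equiv> I \<rightarrow>\<^sub>E carrier P"
abbreviation "e \<equiv> eta_tuple eta I"

lemma lam_in: "i \<in> I \<Longrightarrow> lam i \<in> I"
  using lam by (auto dest: bij_betwE)

lemma rho_in: "i \<in> I \<Longrightarrow> rho i \<in> I"
  using rho by (auto dest: bij_betwE)

lemma uneta_eta: "a \<in> PI \<Longrightarrow> uneta_tuple P eta I (e a) = a"
  by (auto simp: uneta_tuple_def eta_tuple_def PiE_iff extensional_def fun_eq_iff
      bij_betw_inv_into_left[OF eta])

lemma eta_uneta: "x \<in> I \<rightarrow>\<^sub>E E \<Longrightarrow> e (uneta_tuple P eta I x) = x"
  by (auto simp: uneta_tuple_def eta_tuple_def PiE_iff extensional_def fun_eq_iff
      bij_betw_inv_into_right[OF eta])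

lemma uneta_in: "x \<in> I \<rightarrow>\<^sub>E E \<Longrightarrow> uneta_tuple P eta I x \<in> PI"
  using bij_betwE[OF bij_betw_inv_into[OF eta]] by (auto simp: uneta_tuple_def PiE_iff)

lemma eta_in: "a \<in> PI \<Longrightarrow> e a \<in> I \<rightarrow>\<^sub>E E"
  using bij_betwE[OF eta] by (auto simp: eta_tuple_def PiE_iff)

lemma eta_image: "e ` PI = I \<rightarrow>\<^sub>E E"
  using eta_in eta_uneta uneta_in
  by (metis (no_types, lifting) image_eqI image_subsetI subsetI subset_antisym)

lemma inj_eta: "inj_on e PI"
  by (rule inj_on_inverseI[of _ "uneta_tuple P eta I"]) (rule uneta_eta)

text \<open>A single coordinate decides to which half a family belongs; nonemptiness of
  \<open>I\<close> provides one. Over an empty index set both halves would consist of the same empty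
  family.\<close>

lemma halves_disjoint: "PI \<inter> (I \<rightarrow>\<^sub>E E) = {}"
proof -
  obtain i where "i \<in> I" using I by blast
  then show ?thesis using disj by (force simp: PiE_iff)
qed

lemma eta_notin: "a \<in> PI \<Longrightarrow> e a \<notin> PI"
  using eta_in halves_disjoint by blast

abbreviation "kadd \<equiv> kite_add P E eta I lam rho"

lemma kadd_left: "\<lbrakk>a \<in> PI; b \<in> PI\<rbrakk> \<Longrightarrow> kadd a b = tuple_add P I a b"
  by (simp add: kite_add_def)

lemma kadd_eta_eta: "\<lbrakk>a \<in> PI; b \<in> PI\<rbrakk> \<Longrightarrow> kadd (e a) (e b) = None"
  by (simp add: kite_add_def eta_notin)

text \<open>The order condition yields a left complement in each coordinate, and these form the
  family \<open>c\<close>. Conversely, by cancellation any such \<open>c\<close> is the family of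
  quotients in the definition.\<close>

lemma kadd_eta_right:
  assumes a: "a \<in> PI" and b: "b \<in> PI"
  shows "kadd a (e b) = Some z \<longleftrightarrow>
    (\<exists>c\<in>PI. z = e c \<and> tuple_add P I c (reindex I lam a) = Some b)"
proof -
  have b': "b \<in> extensional I" using b by (simp add: PiE_iff)
  have al: "a (lam i) \<in> carrier P" if "i \<in> I" for i
    using a lam_in[OF that] by auto
  have kadd: "kadd a (e b) = (if \<forall>i\<in>I. ple P (a (lam i)) (b i)
      then Some (e (\<lambda>i\<in>I. rquot P (b i) (a (lam i)))) else None)"
    using a b by (simp add: kite_add_def eta_notin eta_in uneta_eta)
  have quot: "(\<lambda>i\<in>I. rquot P (b i) (a (lam i))) = c"
    if "c \<in> PI" "tuple_add P I c (reindex I lam a) = Some b" for c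
  proof (rule extensionalityI[of _ I])
    show "c \<in> extensional I" using that by (simp add: PiE_iff)
    fix i assume "i \<in> I"
    then show "(\<lambda>i\<in>I. rquot P (b i) (a (lam i))) i = c i"
      using that rquot_eq[OF P al, of i "c i" "b i"] by (auto simp: tuple_add_eq_Some)
  qed simp
  show ?thesis
  proof
    assume L: "kadd a (e b) = Some z"
    then have "\<forall>i\<in>I. \<exists>d\<in>carrier P. padd P d (a (lam i)) = Some (b i)"
      using al by (auto simp: kadd ple_iff_left[OF P] split: if_splits)
    from PiE_choice[OF this] obtain c
      where c: "c \<in> PI" "\<forall>i\<in>I. padd P (c i) (a (lam i)) = Some (b i)" by blast
    then have "tuple_add P I c (reindex I lam a) = Some b" by (simp add: tuple_add_eq_Some b')
    with L c quot show "\<exists>c\<in>PI. z = e c \<and> tuple_add P I c (reindex I lam a) = Some b"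
      by (auto simp: kadd split: if_splits)
  next
    assume "\<exists>c\<in>PI. z = e c \<and> tuple_add P I c (reindex I lam a) = Some b"
    then obtain c where c: "c \<in> PI" "z = e c" "tuple_add P I c (reindex I lam a) = Some b" by blast
    then have "ple P (a (lam i)) (b i)" if "i \<in> I" for i
      unfolding ple_iff_left[OF P al[OF that]] using that by (auto simp: tuple_add_eq_Some)
    then show "kadd a (e b) = Some z" using c quot by (simp add: kadd)
  qed
qed

text \<open>The argument is dual, and right complements come directly from the definition of the
  order.\<close>

lemma kadd_eta_left:
  assumes a: "a \<in> PI" and b: "b \<in> PI"
  shows "kadd (e a) b = Some z \<longleftrightarrow>
    (\<exists>c\<in>PI. z = e c \<and> tuple_add P I (reindex I rho b) c = Some a)"
proof -
  have a': "a \<in> extensional I" using a by (simp add: PiE_iff)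
  have br: "b (rho i) \<in> carrier P" if "i \<in> I" for i
    using b rho_in[OF that] by auto
  have kadd: "kadd (e a) b = (if \<forall>i\<in>I. ple P (b (rho i)) (a i)
      then Some (e (\<lambda>i\<in>I. lquot P (b (rho i)) (a i))) else None)"
    using a b by (simp add: kite_add_def eta_notin eta_in uneta_eta)
  have quot: "(\<lambda>i\<in>I. lquot P (b (rho i)) (a i)) = c"
    if "c \<in> PI" "tuple_add P I (reindex I rho b) c = Some a" for c
  proof (rule extensionalityI[of _ I])
    show "c \<in> extensional I" using that by (simp add: PiE_iff)
    fix i assume "i \<in> I"
    then show "(\<lambda>i\<in>I. lquot P (b (rho i)) (a i)) i = c i"
      using that lquot_eq[OF P br, of i "c i" "a i"] by (auto simp: tuple_add_eq_Some)
  qed simp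
  show ?thesis
  proof
    assume L: "kadd (e a) b = Some z"
    then have "\<forall>i\<in>I. \<exists>d\<in>carrier P. padd P (b (rho i)) d = Some (a i)"
      by (auto simp: kadd ple_def split: if_splits)
    from PiE_choice[OF this] obtain c
      where c: "c \<in> PI" "\<forall>i\<in>I. padd P (b (rho i)) (c i) = Some (a i)" by blast
    then have "tuple_add P I (reindex I rho b) c = Some a" by (simp add: tuple_add_eq_Some a')
    with L c quot show "\<exists>c\<in>PI. z = e c \<and> tuple_add P I (reindex I rho b) c = Some a"
      by (auto simp: kadd split: if_splits)
  next
    assume "\<exists>c\<in>PI. z = e c \<and> tuple_add P I (reindex I rho b) c = Some a"
    then obtain c where c: "c \<in> PI" "z = e c" "tuple_add P I (reindex I rho b) c = Some a" by blast
    then have "ple P (b (rho i)) (a i)" if "i \<in> I" for i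
      unfolding ple_def using that by (auto simp: tuple_add_eq_Some)
    then show "kadd (e a) b = Some z" using c quot by (simp add: kadd)
  qed
qed

lemma carrier_kite: "carrier (kite P E eta I lam rho) = PI \<union> e ` PI"
  unfolding eta_image by (simp add: kite_def)

text \<open>The power is doubled with \<open>lam\<close> and \<open>rho\<close> as reindexing
  twists. Coordinatewise, the twist condition is exactly (KCI).\<close>

lemma pea_kite:
  assumes kci: "KCI P I lam rho"
  shows "pea (kite P E eta I lam rho)"
proof (rule pea_of_twisted_double[where G = "power_algebra P I" and e = e
      and l = "reindex I lam" and r = "reindex I rho"]; (simp only: power_algebra_simps)?)
  show "gpea (power_algebra P I)" by (rule gpea_power_algebra[OF P])
  show "bij_betw (reindex I lam) PI PI" by (rule bij_betw_reindex[OF lam])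
  show "bij_betw (reindex I rho) PI PI" by (rule bij_betw_reindex[OF rho])
  show "inj_on e PI" by (rule inj_eta)
  show "PI \<inter> e ` PI = {}" unfolding eta_image by (rule halves_disjoint)
  show "carrier (kite P E eta I lam rho) = PI \<union> e ` PI" by (rule carrier_kite)
  show "pzero (kite P E eta I lam rho) = (\<lambda>i\<in>I. pzero P)" by (simp add: kite_def)
  show "pone (kite P E eta I lam rho) = e (\<lambda>i\<in>I. pzero P)"
    by (auto simp: kite_def eta_tuple_def)
next
  fix a b assume ab: "a \<in> PI" "b \<in> PI"
  show "tuple_add P I (reindex I rho a) b \<noteq> None \<longleftrightarrow> tuple_add P I b (reindex I lam a) \<noteq> None"
    using kci ab unfolding KCI_def tuple_add_defined by simp
qed (simp_all add: kite_def kadd_left kadd_eta_right kadd_eta_left kadd_eta_eta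
    tuple_add_reindex[OF lam] tuple_add_reindex[OF rho] PiE_iff[of _ I])

end

text \<open>On \<open>I\<close>, \<open>kite_gamma\<close> is reindexing along
  \<open>rho \<circ> inv_into I lam\<close>, so the two sums have the same defining clauses. Results
  about kites thereby apply to the unitization.\<close>

lemma power_unitization_eq_kite:
  shows "power_unitization P E eta I (kite_gamma I lam rho)
    = kite P E eta I id (rho \<circ> inv_into I lam)"
proof -
  have "unitization_add P E eta I (kite_gamma I lam rho) x y
      = kite_add P E eta I id (rho \<circ> inv_into I lam) x y" for x y
    by (simp add: unitization_add_def kite_add_def kite_gamma_def Let_def cong: restrict_cong)
  then show ?thesis
    by (simp add: power_unitization_def kite_def fun_eq_iff)
qed

section \<open>The isomorphism from the unitization onto the kite, and its uniqueness\<close>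

theorem theorem3p9:
  fixes P :: "'a partial_algebra" and E :: "'a set" and eta :: "'a \<Rightarrow> 'a"
    and I :: "'i set" and lam rho :: "'i \<Rightarrow> 'i"
  assumes "gpea P"
    and "I \<noteq> {}"
    and "bij_betw lam I I" and "bij_betw rho I I"
    and "carrier P \<inter> E = {}" and "bij_betw eta (carrier P) E"
    and "KCI P I lam rho"
  shows "let U = power_unitization P E eta I (kite_gamma I lam rho);
             K = kite P E eta I lam rho;
             phi = kite_phi P eta I lam
         in pea U \<and> partial_isomorphism U K phi \<and>
            (\<forall>a \<in> I \<rightarrow>\<^sub>E carrier P. phi a = a) \<and>
            pea K \<and> is_kite_algebra P E eta I lam rho \<and>
            pea_isomorphism U K phi \<and>
            (\<forall>psi. pea_morphism U K psi \<and> (\<forall>a \<in> I \<rightarrow>\<^sub>E carrier P. psi a = a) \<longrightarrow>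
               (\<forall>x \<in> carrier U. psi x = phi x))"
proof -
  let ?rho = "rho \<circ> inv_into I lam"
  let ?U = "power_unitization P E eta I (kite_gamma I lam rho)"
  let ?K = "kite P E eta I lam rho"
  let ?phi = "kite_phi P eta I lam"
  let ?l = "reindex I lam"
  note lam = assms(3) and rho = assms(4)
  have inv: "bij_betw (inv_into I lam) I I" by (rule bij_betw_inv_into[OF lam])
  interpret K: kite_data P E eta I lam rho
    using assms by unfold_locales
  interpret U: kite_data P E eta I id ?rho
    using assms by unfold_locales (auto intro: bij_betw_trans[OF inv])
  have U_eq: "?U = kite P E eta I id ?rho"
    by (rule power_unitization_eq_kite)
  have "KCI P I id ?rho"
    unfolding KCI_def
  proof (intro ballI)
    fix a b i assume ab: "a \<in> K.PI" "b \<in> K.PI" and i: "i \<in> I"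
    let ?j = "inv_into I lam i"
    have "?j \<in> I" "lam ?j = i"
      using i bij_betwE[OF inv] bij_betw_inv_into_right[OF lam] by blast+
    \<comment> \<open>(KCI) is applied at \<open>?j\<close>, where \<open>lam ?j = i\<close> and
      \<open>rho ?j = ?rho i\<close>. There it would involve \<open>b ?j\<close> instead of
      \<open>b i\<close>, so \<open>b\<close> is replaced by the constant family with value
      \<open>b i\<close>.\<close>
    moreover have "(\<lambda>_\<in>I. b i) \<in> K.PI" using ab i by auto
    ultimately show "padd P (a (?rho i)) (b i) \<noteq> None \<longleftrightarrow> padd P (b i) (a (id i)) \<noteq> None"
      using assms(7)[unfolded KCI_def, THEN bspec, OF ab(1), THEN bspec, of "\<lambda>_\<in>I. b i",
          THEN bspec, of ?j] by simp
  qed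
  then have peaU: "pea ?U" unfolding U_eq by (rule U.pea_kite)
  have peaK: "pea ?K" using K.pea_kite assms(7) .
  have l_in: "?l a \<in> K.PI" if "a \<in> K.PI" for a
    using bij_betwE[OF bij_betw_reindex[OF lam, of "carrier P"]] that by blast
  have l_sur: "\<exists>b\<in>K.PI. a = ?l b" if "a \<in> K.PI" for a
    using bij_betw_imp_surj_on[OF bij_betw_reindex[OF lam, of "carrier P"]] that by blast
  have phi_PI: "?phi a = a" if "a \<in> K.PI" for a
    using that by (simp add: kite_phi_def)
  have phi_eta: "?phi (K.e a) = K.e (?l a)" if "a \<in> K.PI" for a
    using that by (simp add: kite_phi_def K.eta_notin K.uneta_eta reindex_def)
  \<comment> \<open>Reindexing commutes with the coordinatewise \<open>eta\<close>, so on this half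
    \<open>phi\<close> is itself a reindexing and therefore bijective.\<close>
  have phi_E: "?phi x = ?l x" if "x \<in> I \<rightarrow>\<^sub>E E" for x
  proof -
    obtain a where "a \<in> K.PI" "x = K.e a" using \<open>x \<in> I \<rightarrow>\<^sub>E E\<close> K.eta_image by blast
    moreover have "K.e (?l a) = ?l (K.e a)"
      by (auto simp: eta_tuple_def reindex_def K.lam_in)
    ultimately show ?thesis using phi_eta by simp
  qed
  have bij: "bij_betw ?phi (carrier ?U) (carrier ?K)"
  proof -
    have "bij_betw ?phi K.PI K.PI" using bij_betw_cong[of K.PI ?phi id K.PI] phi_PI by simp
    moreover have "bij_betw ?phi (I \<rightarrow>\<^sub>E E) (I \<rightarrow>\<^sub>E E)"
      by (rule bij_betw_cong[THEN iffD2, OF phi_E bij_betw_reindex[OF lam]])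
    ultimately show ?thesis
      using bij_betw_combine K.halves_disjoint by (force simp: kite_def power_unitization_def)
  qed
  have phi_add: "K.kadd (?phi x) (?phi y) = map_option ?phi (U.kadd x y)"
    if "x \<in> K.PI \<union> K.e ` K.PI" "y \<in> K.PI \<union> K.e ` K.PI" for x y
  proof (rule option_eqI)
    fix w
    have "K.kadd (?phi x) (?phi y) = Some w \<longleftrightarrow> (\<exists>z. U.kadd x y = Some z \<and> w = ?phi z)"
      using that
    proof (elim UnE imageE)
      assume ab: "x \<in> K.PI" "y \<in> K.PI"
      then have "z \<in> K.PI" if "tuple_add P I x y = Some z" for z
        using gpea_closed[OF gpea_power_algebra[OF assms(1)], of x I y z] that by simp
      with ab show ?thesis by (auto simp: phi_PI K.kadd_left U.kadd_left)
    next
      fix b assume ab: "x \<in> K.PI" "b \<in> K.PI" "y = K.e b"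
      have "reindex I id x = x" using ab by (auto simp: reindex_def PiE_iff extensional_def)
      \<comment> \<open>Applying the automorphism \<open>?l\<close> to the relation
        \<open>c \<oplus> x = b\<close> of the unitization gives the relation
        \<open>?l c \<oplus> ?l x = ?l b\<close> of the kite, and every candidate in the kite has
        the form \<open>?l c\<close>.\<close>
      moreover have "(\<exists>c\<in>K.PI. w = K.e c \<and> tuple_add P I c (?l x) = Some (?l b)) \<longleftrightarrow>
        (\<exists>c\<in>K.PI. w = K.e (?l c) \<and> tuple_add P I c x = Some b)"
        using tuple_add_reindex[OF lam, of b] ab l_in l_sur
        by (metis PiE_restrict restrict_extensional)
      ultimately show ?thesis
        using ab by (auto simp: phi_PI phi_eta l_in K.kadd_eta_right U.kadd_eta_right)
    next
      fix a assume ab: "a \<in> K.PI" "x = K.e a" "y \<in> K.PI"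
      \<comment> \<open>Along \<open>lam\<close>, the inverse of \<open>lam\<close> inside
        \<open>?rho\<close> cancels. Hence \<open>?l\<close> carries the right twist of the
        unitization to that of the kite.\<close>
      have "reindex I rho y = ?l (reindex I ?rho y)"
        by (auto simp: reindex_def fun_eq_iff K.lam_in bij_betw_inv_into_left[OF lam])
      then have "(\<exists>c\<in>K.PI. w = K.e c \<and> tuple_add P I (reindex I rho y) c = Some (?l a)) \<longleftrightarrow>
        (\<exists>c\<in>K.PI. w = K.e (?l c) \<and> tuple_add P I (reindex I ?rho y) c = Some a)"
        using tuple_add_reindex[OF lam, of a] ab l_in l_sur
        by (metis PiE_restrict restrict_extensional)
      then show ?thesis
        using ab by (auto simp: phi_PI phi_eta l_in K.kadd_eta_left U.kadd_eta_left)
    next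
      fix a b assume "a \<in> K.PI" "x = K.e a" "b \<in> K.PI" "y = K.e b"
      then show ?thesis by (simp add: phi_eta l_in K.kadd_eta_eta U.kadd_eta_eta)
    qed
    then show "K.kadd (?phi x) (?phi y) = Some w \<longleftrightarrow> map_option ?phi (U.kadd x y) = Some w"
      by auto
  qed
  have zero_in: "(\<lambda>i\<in>I. pzero P) \<in> K.PI" using gpea_zero[OF assms(1)] by auto
  have one_eq: "(\<lambda>i\<in>I. eta (pzero P)) = K.e (\<lambda>i\<in>I. pzero P)"
    by (auto simp: eta_tuple_def)
  have "?l (\<lambda>i\<in>I. pzero P) = (\<lambda>i\<in>I. pzero P)"
    by (auto simp: reindex_def K.lam_in)
  then have "?phi (pone ?U) = pone ?K"
    unfolding U_eq using phi_eta[OF zero_in] by (simp add: kite_def one_eq)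
  moreover have "?phi (pzero ?U) = pzero ?K"
    unfolding U_eq using phi_PI[OF zero_in] by (simp add: kite_def)
  moreover have "padd ?K (?phi x) (?phi y) = map_option ?phi (padd ?U x y)"
    if "x \<in> carrier ?U" "y \<in> carrier ?U" for x y
    using phi_add that unfolding U_eq U.carrier_kite by (simp add: kite_def)
  ultimately have iso: "partial_isomorphism ?U ?K ?phi"
    using bij unfolding partial_isomorphism_def by blast
  then have pea_iso: "pea_isomorphism ?U ?K ?phi"
    using peaU peaK by (rule partial_isomorphism_imp_pea_isomorphism)
  have "psi x = ?phi x"
    if psi: "pea_morphism ?U ?K psi" "\<forall>a\<in>K.PI. psi a = a" and x: "x \<in> carrier ?U" for psi x
  proof (cases "x \<in> K.PI")
    case True
    then show ?thesis using psi(2) phi_PI by simp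
  next
    case False
    then obtain a where a: "a \<in> K.PI" "x = K.e a" using x unfolding U_eq U.carrier_kite by blast
    have aU: "a \<in> carrier ?U" and aK: "a \<in> carrier ?K"
      using a unfolding U_eq U.carrier_kite K.carrier_kite by blast+
    have "reindex I id a = a" using a by (auto simp: reindex_def PiE_iff extensional_def)
    moreover have "tuple_add P I (\<lambda>i\<in>I. pzero P) a = Some a"
      using gpea_zero_add[OF gpea_power_algebra[OF assms(1)], of a I] a by simp
    ultimately have "padd ?U a x = Some (pone ?U)"
      unfolding U_eq using a zero_in U.kadd_eta_right[of a a "K.e (\<lambda>i\<in>I. pzero P)"]
      by (auto simp: kite_def one_eq)
    \<comment> \<open>Any morphism \<open>f\<close> fixing \<open>a\<close> sends
      \<open>a + x = 1\<close> to \<open>a + f x = 1\<close> in the kite. Used for both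
      \<open>psi\<close> and \<open>phi\<close>, this lets left cancellation identify their values
      at \<open>x\<close>.\<close>
    then have sum: "padd ?K a (f x) = Some (pone ?K)" and "f x \<in> carrier ?K"
      if "pea_morphism ?U ?K f" "f a = a" for f
      using that aU x unfolding pea_morphism_def by (metis, blast)
    moreover have "pea_morphism ?U ?K ?phi" using pea_iso unfolding pea_isomorphism_def by blast
    moreover have "gpea ?K" using peaK unfolding pea_def by blast
    ultimately show ?thesis
      using psi a(1) phi_PI aK by (metis gpea_cancel_left)
  qed
  then show ?thesis
    using peaU iso phi_PI peaK pea_iso unfolding Let_def is_kite_algebra_def by blast
qed

end
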